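(* One has $b(1)=b(2)=b(3)=0$, $b(\Gamma_{2,1,1})=b([4])=[1]$, $b(\Gamma_{1,1,1})=b([5,6])=[0,1]$, $b(\Gamma_{2,2,1})=b([7,8])=[1,1]$, $b(\Gamma_{1,2,1})=b([9,10,11])=[1,1,2]$, and for every $m\ge 3$, $$b(\Gamma_{1,m,1})=[b(\Gamma_{2,m-1,1}),b(\Gamma_{1,m-1,1})]+[0,\underbrace{1,\ldots,1}_{f_m-1}],$$ $$b(\Gamma_{2,m,1})=[b(\Gamma_{2,m-2,1}),b(\Gamma_{1,m-2,1})]+[\underbrace{1,\ldots,1}_{f_{m-3}+1},\underbrace{0,\ldots,0}_{f_{m-2}-1}].$$
   Context: The Fibonacci sequence $\mathbb{F}$ is the infinite word over $\{a,b\}$ that is the fixed point beginning with $a$ of the morphism $\sigma(a)=ab$, $\sigma(b)=a$; $\mathbb{F}[1,n]$ is its prefix of length $n$. For a nonempty factor $\omega$ of $\mathbb{F}$, $\omega_p$ denotes its $p$-th occurrence in $\mathbb{F}$; $\omega_p\omega_{p+1}$ is a square occurrence when the $(p+1)$-th occurrence of $\omega$ starts right after the $p$-th one ends. $b(n)=\sharp\{(\omega,p):\omega_p\omega_{p+1}\triangleright\mathbb{F}[1,n]\}$ is the number of square occurrences $\omega_p\omega_{p+1}$ that end at position $n$ (i.e. are a suffix of $\mathbb{F}[1,n]$). The Fibonacci numbers are indexed by $f_{-2}=0$, $f_{-1}=1$, $f_{m+1}=f_m+f_{m-1}$ for $m\ge -1$ (so $f_0=1$, $f_1=2$, $f_2=3$).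 For $m\ge1$, $\Gamma_{1,m,1}=[2f_{m+1}-1,\ldots,f_{m+3}-2]$ and $\Gamma_{2,m,1}=[f_{m+2}-1,\ldots,2f_{m+1}-2]$ are vectors of consecutive integers (of lengths $f_m$ and $f_{m-1}$). For a vector $[n_1,\ldots,n_k]$, $b([n_1,\ldots,n_k])=[b(n_1),\ldots,b(n_k)]$; $[u,v]$ for vectors $u,v$ denotes concatenation, and $+$ is componentwise addition. *)

theory Defs
  imports Complex_Main "HOL-Library.Stream" "HOL-Library.Sublist" "HOL-Number_Theory.Fib"
begin

datatype letter = La | Lb

fun sigma :: "letter \<Rightarrow> letter list" where
  "sigma La = [La, Lb]"
| "sigma Lb = [La]"

definition sigma_word :: "letter list \<Rightarrow> letter list" where
  "sigma_word w = concat (map sigma w)"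

definition sigma_inf :: "letter stream \<Rightarrow> letter stream" where
  "sigma_inf s = flat (smap sigma s)"

definition fib_word :: "letter stream" where
  "fib_word = (THE s. shd s = La \<and> sigma_inf s = s)"

(* Positions in fib_word are counted from 1, whereas streams are indexed from 0. *)
definition occurs_at :: "letter list \<Rightarrow> nat \<Rightarrow> bool" where
  "occurs_at w i \<longleftrightarrow> 1 \<le> i \<and> stake (length w) (sdrop (i - 1) fib_word) = w"

(* The p-th occurrence of w (p counted from 1, overlapping occurrences included)
   starts at position i. *)
definition nth_occurrence :: "letter list \<Rightarrow> nat \<Rightarrow> nat \<Rightarrow> bool" where
  "nth_occurrence w p i \<longleftrightarrow> occurs_at w i \<and> card {j. j \<le> i \<and> occurs_at w j} = p"

(* The p-th and the (p+1)-th occurrence of w are adjacent, and the latter ends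
   at position n. *)
definition square_ends_at :: "letter list \<Rightarrow> nat \<Rightarrow> nat \<Rightarrow> bool" where
  "square_ends_at w p n \<longleftrightarrow>
     w \<noteq> [] \<and> (\<exists>i. nth_occurrence w p i \<and> nth_occurrence w (p + 1) (i + length w)
       \<and> n + 1 = i + 2 * length w)"

definition sq_count :: "nat \<Rightarrow> nat" where
  "sq_count n = card {(w, p). square_ends_at w p n}"

(* Shifted Fibonacci numbers: fib_sh (-2) = 0, fib_sh (-1) = 1, fib_sh 0 = 1, fib_sh 1 = 2;
   only used for m \<ge> -2. *)
definition fib_sh :: "int \<Rightarrow> nat" where
  "fib_sh m = fib (nat (m + 2))"

definition Gamma1 :: "int \<Rightarrow> nat list" where
  "Gamma1 m = [2 * fib_sh (m + 1) - 1 ..< Suc (fib_sh (m + 3) - 2)]"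

definition Gamma2 :: "int \<Rightarrow> nat list" where
  "Gamma2 m = [fib_sh (m + 2) - 1 ..< Suc (2 * fib_sh (m + 1) - 2)]"

(* map2 truncates to the shorter list; vec_add is only used on vectors of equal
   length, see length_Gamma1 and length_Gamma2. *)
definition vec_add :: "nat list \<Rightarrow> nat list \<Rightarrow> nat list" where
  "vec_add u v = map2 (+) u v"

lemma fib_sh_init: "fib_sh (-2) = 0" "fib_sh (-1) = 1"
  by (simp_all add: fib_sh_def)

lemma fib_sh_rec: "m \<ge> -1 \<Longrightarrow> fib_sh (m + 1) = fib_sh m + fib_sh (m - 1)"
proof -
  assume "m \<ge> -1"
  then obtain k where "m = int k - 1" by (metis add.commute diff_add_cancel zero_le_imp_eq_int
      add_increasing2 diff_ge_0_iff_ge diff_minus_eq_add add_diff_cancel_right')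
  then have "nat (m + 3) = Suc (Suc k)" "nat (m + 2) = Suc k" "nat (m + 1) = k" by auto
  then show ?thesis by (simp add: fib_sh_def algebra_simps)
qed

lemma fib_sh_pos: "m \<ge> -1 \<Longrightarrow> fib_sh m > 0"
  by (auto simp: fib_sh_def intro!: fib_neq_0_nat)

lemma length_Gamma1: "m \<ge> 1 \<Longrightarrow> length (Gamma1 m) = fib_sh m"
  using fib_sh_rec[of "m+2"] fib_sh_rec[of "m+1"] fib_sh_rec[of m] fib_sh_pos[of m] fib_sh_pos[of "m-1"]
  by (simp add: Gamma1_def algebra_simps)

lemma length_Gamma2: "m \<ge> 1 \<Longrightarrow> length (Gamma2 m) = fib_sh (m - 1)"
  using fib_sh_rec[of "m+1"] fib_sh_rec[of m] fib_sh_pos[of m] fib_sh_pos[of "m-1"]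
  by (simp add: Gamma2_def algebra_simps)

lemma finite_square_ends_at: "finite {(w, p). square_ends_at w p n}"
proof (rule finite_subset)
  show "{(w, p). square_ends_at w p n} \<subseteq> {w. set w \<subseteq> {La, Lb} \<and> length w \<le> n} \<times> {..n + 1}"
  proof (rule subrelI)
    fix w p assume "(w, p) \<in> {(w, p). square_ends_at w p n}"
    then obtain i where i: "nth_occurrence w p i" "n + 1 = i + 2 * length w" "w \<noteq> []"
      by (auto simp: square_ends_at_def)
    from i have "1 \<le> i" by (auto simp: nth_occurrence_def occurs_at_def)
    with i have "length w \<le> n" by simp
    have "card {j. j \<le> i \<and> occurs_at w j} \<le> card {1..i}"
      by (rule card_mono) (auto simp: occurs_at_def)
    with i have "p \<le> n + 1" by (simp add: nth_occurrence_def)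
    moreover have "set w \<subseteq> {La, Lb}" using letter.exhaust by blast
    ultimately show "(w, p) \<in> {w. set w \<subseteq> {La, Lb} \<and> length w \<le> n} \<times> {..n + 1}"
      using \<open>length w \<le> n\<close> by simp
  qed
  show "finite ({w. set w \<subseteq> {La, Lb} \<and> length w \<le> n} \<times> {..n + 1})"
    by (intro finite_cartesian_product finite_lists_length_le) auto
qed

lemma sigma_ne [simp]: "sigma x \<noteq> []"
  by (cases x) auto

lemma sigma_inf_shift: "sigma_inf s = sigma_word (stake k s) @- sigma_inf (sdrop k s)"
proof (induction k arbitrary: s)
  case 0
  then show ?case by (simp add: sigma_word_def)
next
  case (Suc k)
  have "sigma_inf s = sigma (shd s) @- sigma_inf (stl s)"
    unfolding sigma_inf_def by (subst stream.collapse[symmetric, of s])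
      (simp only: stream.map stream.sel flat_Stream sigma_ne not_False_eq_True)
  also have "\<dots> = sigma (shd s) @- sigma_word (stake k (stl s)) @- sigma_inf (sdrop k (stl s))"
    by (subst Suc.IH[of "stl s"]) (rule refl)
  finally show ?case by (simp add: sigma_word_def)
qed

lemma length_sigma_word: "length (sigma_word w) \<ge> length w"
proof (induction w)
  case (Cons x w)
  then show ?case by (cases x) (auto simp: sigma_word_def)
qed (simp add: sigma_word_def)

lemma length_sigma_word_La: "length (sigma_word (La # w)) \<ge> Suc (length (La # w))"
  using length_sigma_word[of w] by (simp add: sigma_word_def)

lemma stake_sigma_inf:
  assumes "n \<le> length (sigma_word (stake k s))"
  shows "stake n (sigma_inf s) = take n (sigma_word (stake k s))"
  using assms by (subst sigma_inf_shift[of s k]) (simp add: stake_shift min_def)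

fun sigma_iter :: "nat \<Rightarrow> letter list" where
  "sigma_iter 0 = [La]"
| "sigma_iter (Suc n) = sigma_word (sigma_iter n)"

lemma prefix_sigma_word: "prefix u v \<Longrightarrow> prefix (sigma_word u) (sigma_word v)"
  by (auto simp: prefix_def sigma_word_def)

lemma prefix_sigma_iter_Suc: "prefix (sigma_iter n) (sigma_iter (Suc n))"
  by (induction n) (auto simp: prefix_sigma_word, simp add: sigma_word_def)

lemma prefix_sigma_iter: "m \<le> n \<Longrightarrow> prefix (sigma_iter m) (sigma_iter n)"
proof (induction n rule: dec_induct)
  case (step n)
  then show ?case using prefix_sigma_iter_Suc[of n] prefix_order.trans by blast
qed simp

lemma length_sigma_iter: "length (sigma_iter n) \<ge> Suc n"
proof (induction n)
  case (Suc n)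
  have "prefix [La] (sigma_iter n)" using prefix_sigma_iter[of 0 n] by simp
  then obtain v where "sigma_iter n = La # v" by (auto simp: prefix_def)
  with length_sigma_word_La[of v] Suc show ?case by simp
qed simp

lemma stream_eqI_stake:
  assumes "\<And>n. stake (Suc n) s = stake (Suc n) t"
  shows "s = t"
proof -
  have "s !! n = t !! n" for n
    using assms[of n] by (metis lessI stake_nth)
  then have "smap (snth s) nats = smap (snth t) nats" by presburger
  then show ?thesis by (simp add: stream_smap_nats[symmetric])
qed

lemma ex1_fib_word: "\<exists>!s. shd s = La \<and> sigma_inf s = s"
proof
  define s where "s = smap (\<lambda>i. sigma_iter i ! i) nats"
  have nth: "s !! i = sigma_iter n ! i" if "i \<le> n" for i n
    using prefix_sigma_iter[OF that] length_sigma_iter[of i]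
    by (auto simp: s_def prefix_def nth_append)
  have st: "stake k s = take k (sigma_iter n)" if "k \<le> Suc n" for k n
    using that length_sigma_iter[of n] by (auto intro!: nth_equalityI simp: nth)
  have "stake n (sigma_inf s) = stake n s" for n
  proof -
    have "stake n (sigma_inf s) = take n (sigma_word (stake n s))"
      by (rule stake_sigma_inf) (use length_sigma_word[of "stake n s"] in simp)
    also have "\<dots> = take n (sigma_word (take n (sigma_iter n)))"
      using st[of n n] by simp
    also have "\<dots> = take n (sigma_iter (Suc n))"
    proof -
      have "prefix (sigma_word (take n (sigma_iter n))) (sigma_iter (Suc n))"
        by (simp add: prefix_sigma_word take_is_prefix)
      moreover have "length (sigma_word (take n (sigma_iter n))) \<ge> n"
        using length_sigma_word[of "take n (sigma_iter n)"] length_sigma_iter[of n] by simp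
      ultimately show ?thesis by (auto simp: prefix_def)
    qed
    also have "\<dots> = stake n s" using st[of n "Suc n"] by simp
    finally show ?thesis .
  qed
  moreover have "s !! 0 = La" using nth[of 0 0] by simp
  ultimately show s: "shd s = La \<and> sigma_inf s = s"
    using stream_eqI_stake[of "sigma_inf s" s] by simp
  fix t assume t: "shd t = La \<and> sigma_inf t = t"
  have "stake (Suc n) t = stake (Suc n) s" for n
  proof (induction n)
    case 0
    then show ?case using s t by simp
  next
    case (Suc n)
    have l: "Suc (Suc n) \<le> length (sigma_word (stake (Suc n) s))"
      using length_sigma_word_La[of "stake n (stl s)"] s by simp
    show ?case
      using stake_sigma_inf[OF l] stake_sigma_inf[of "Suc (Suc n)" "Suc n" t] Suc l s t by metis
  qed
  then show "t = s"
    by (rule stream_eqI_stake)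
qed

lemma fib_word: "shd fib_word = La" "sigma_inf fib_word = fib_word"
  using theI'[OF ex1_fib_word] unfolding fib_word_def by auto

end

theory Submission
  imports Defs
begin

text \<open>
  Write \<open>x\<close> for the Fibonacci word, indexed from \<open>0\<close>, and \<open>f m\<close> for the shifted Fibonacci
  numbers. For \<open>m \<ge> 3\<close> the two lists with index \<open>m\<close> together cover the positions \<open>n\<close> with
  \<open>f (m + 2) - 1 \<le> n \<le> f (m + 3) - 2\<close>, and both recurrences compare the squares ending at \<open>n\<close>
  with those ending at \<open>n - f (m + 1)\<close>.

  The prefix of \<open>x\<close> of length \<open>f (m + 3) - 2\<close> has period \<open>f (m + 1)\<close> (\<open>fw_add_fib_eq\<close>), so
  shifting by \<open>f (m + 1)\<close> matches the squares ending at \<open>n\<close> that start at or after position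
  \<open>f (m + 1)\<close> with all squares ending at \<open>n - f (m + 1)\<close> (\<open>square_period_shift\<close>). What remains are
  the squares ending at \<open>n\<close> that start earlier. Every square in \<open>x\<close> has Fibonacci length, and
  length considerations leave only the roots of length \<open>f (m - 1)\<close>, \<open>f m\<close>, \<open>f (m + 1)\<close>. Knowing
  where \<open>x\<close> first agrees and disagrees with its shift by a Fibonacci number (\<open>fw_add_fib_eq\<close>,
  \<open>fw_add_fib_neq\<close>, \<open>fw_add_fib_eq_second_run\<close>), one finds exactly one such square if
  \<open>n \<ge> 2 f (m + 1)\<close> (root length \<open>f (m + 1)\<close>) or \<open>n < f (m + 2) + f (m - 3)\<close> (root length
  \<open>f (m - 1)\<close>), and none otherwise (\<open>new_squares\<close>). These two ranges are the blocks of ones in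
  the recurrences.

  That square roots have Fibonacci length is proved by desubstitution (\<open>near_square_fib\<close>). The
  descent also shows that the number of letters \<open>a\<close> in the root is the preceding Fibonacci
  number. Consecutive Fibonacci numbers are coprime, so a root is never a proper power; hence the
  two halves of a square are always consecutive occurrences of the root, and counting pairs
  \<open>(\<omega>, p)\<close> is the same as counting lengths of square roots (\<open>sq_count_eq\<close>).
\<close>

section \<open>Block structure of the Fibonacci word\<close>

definition fw :: "nat \<Rightarrow> letter" where
  "fw n = fib_word !! n"

definition count_a :: "nat \<Rightarrow> nat" where
  "count_a n = (\<Sum>j<n. of_bool (fw j = La))"

text \<open>
  The block \<open>\<sigma>(x\<^sub>m)\<close> of the factorization \<open>x = \<sigma>(x\<^sub>0) \<sigma>(x\<^sub>1) \<dots>\<close> has length \<open>2\<close> if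
  \<open>x\<^sub>m = a\<close> and \<open>1\<close> otherwise, so it starts at this position.
\<close>
definition block_start :: "nat \<Rightarrow> nat" where
  "block_start m = m + count_a m"

lemma count_a_0 [simp]: "count_a 0 = 0"
  by (simp add: count_a_def)

lemma count_a_Suc [simp]: "count_a (Suc n) = count_a n + of_bool (fw n = La)"
  by (simp add: count_a_def)

lemma count_a_mono: "m \<le> n \<Longrightarrow> count_a m \<le> count_a n"
  unfolding count_a_def by (rule sum_mono2) auto

lemma letter_cases: "c \<noteq> La \<longleftrightarrow> c = Lb"
  by (cases c) auto

lemma block_start_0 [simp]: "block_start 0 = 0"
  by (simp add: block_start_def)

lemma block_start_Suc: "block_start (Suc m) = block_start m + (if fw m = La then 2 else 1)"
  by (simp add: block_start_def)

lemma strict_mono_block_start: "strict_mono block_start"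
  by (simp add: strict_mono_Suc_iff block_start_Suc)

lemma length_sigma_stake: "length (sigma_word (stake m fib_word)) = block_start m"
proof (induction m)
  case (Suc m)
  then show ?case
    by (cases "fw m") (simp_all add: stake_Suc sigma_word_def block_start_Suc fw_def del: stake.simps)
qed (simp add: sigma_word_def)

lemma sdrop_block_start: "sdrop (block_start m) fib_word = sigma_inf (sdrop m fib_word)"
  using sigma_inf_shift[of fib_word m] fib_word(2)
  by (metis length_sigma_stake sdrop_shift drop_all order_refl diff_self_eq_0 shift.simps(1) sdrop.simps(1))

lemma sigma_inf_unfold: "sigma_inf s = sigma (shd s) @- sigma_inf (stl s)"
  using sigma_inf_shift[of s 1] by (simp add: sigma_word_def)

lemma fw_block_start [simp]: "fw (block_start m) = La"
proof -
  have "fw (block_start m) = shd (sdrop (block_start m) fib_word)"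
    by (simp add: fw_def)
  also have "\<dots> = La"
    by (subst sdrop_block_start, subst sigma_inf_unfold) (cases "shd (sdrop m fib_word)", simp_all)
  finally show ?thesis .
qed

lemma fw_Suc_block_start: "fw (Suc (block_start m)) = Lb \<longleftrightarrow> fw m = La"
proof (cases "fw m")
  case La
  have "fw (Suc (block_start m)) = sdrop (block_start m) fib_word !! 1"
    by (simp add: fw_def sdrop_snth)
  also have "\<dots> = Lb"
    using La by (subst sdrop_block_start, subst sigma_inf_unfold) (simp add: fw_def)
  finally show ?thesis using La by simp
next
  case Lb
  then have "Suc (block_start m) = block_start (Suc m)"
    by (simp add: block_start_Suc)
  then show ?thesis using Lb fw_block_start[of "Suc m"] by simp
qed

text \<open>Each block contains exactly one \<open>a\<close>, namely its first letter.\<close>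
lemma count_a_block_start [simp]: "count_a (block_start m) = m"
proof (induction m)
  case (Suc m)
  then show ?case
    using fw_Suc_block_start[of m] by (cases "fw m") (auto simp: block_start_Suc numeral_2_eq_2)
qed simp

lemma position_cases:
  obtains m where "n = block_start m" | m where "n = Suc (block_start m)" "fw m = La"
proof -
  have "\<exists>m. n = block_start m \<or> n = Suc (block_start m) \<and> fw m = La"
  proof (induction n)
    case 0
    show ?case using block_start_0 by metis
  next
    case (Suc n)
    then obtain m where "n = block_start m \<or> n = Suc (block_start m) \<and> fw m = La" by blast
    then have "Suc n = block_start m \<or> Suc n = Suc (block_start m) \<and> fw m = La
        \<or> Suc n = block_start (Suc m)"
      by (auto simp: block_start_Suc)
    then show ?case by metis
  qed
  then show ?thesis using that by blast
qed

lemma fw_La_block_start: "fw n = La \<Longrightarrow> \<exists>m. n = block_start m"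
  by (metis fw_Suc_block_start letter.distinct(1) position_cases)

lemma no_bb: "fw n = Lb \<Longrightarrow> fw (Suc n) = La"
proof (cases n rule: position_cases)
  case (2 m)
  then have "Suc n = block_start (Suc m)" by (simp add: block_start_Suc)
  then show ?thesis by simp
qed simp

lemma count_a_add_2: "count_a n < count_a (n + 2)"
  using no_bb[of n] letter_cases[of "fw n"] by (auto simp: numeral_2_eq_2)

section \<open>Periods of squares\<close>

text \<open>
  A near square is a factor \<open>v c v\<close> with a single letter \<open>c\<close> and \<open>|v c| = L\<close>: the agreement with
  the shift by \<open>L\<close> is one letter short of a square. A square need not desubstitute to a square:
  \<open>abaaba\<close>, followed by \<open>b\<close> in the prefix \<open>abaabab = \<sigma>(abaa)\<close>, has root \<open>aba = \<sigma>(ab)\<close>, but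
  \<open>abaa\<close> contains no square with root length \<open>2\<close>, only the near square \<open>aba\<close>. Near squares
  do desubstitute to near squares.
\<close>
definition near_square :: "nat \<Rightarrow> nat \<Rightarrow> bool" where
  "near_square i L \<longleftrightarrow> 1 \<le> L \<and> (\<forall>j. i \<le> j \<and> Suc j < i + L \<longrightarrow> fw j = fw (j + L))"

text \<open>
  Both copies of \<open>v\<close> start with \<open>a\<close> and hence at block boundaries. The letter \<open>x\<^sub>m\<close> can be read off
  from the second letter after the start of its block, so the agreement carries over to the
  preimage. The number \<open>M\<close> of blocks in the root is its number of letters \<open>a\<close>, and \<open>L - M\<close>, the
  number of its letters \<open>b\<close>, is the number of letters \<open>a\<close> in the preimage of the root. Thus
  the pair (length, number of \<open>a\<close>) goes from \<open>(L, M)\<close> to \<open>(M, L - M)\<close>, one Fibonacci step back.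
\<close>
lemma near_square_desubstitute:
  assumes "near_square i L" "2 \<le> L" "fw i = La"
  obtains m M where "near_square m M" "M < L" "count_a (i + L) = count_a i + M"
    "L = M + (count_a (m + M) - count_a m)"
proof -
  have agree: "fw j = fw (j + L)" if "i \<le> j" "Suc j < i + L" for j
    using assms(1) that by (auto simp: near_square_def)
  obtain m where m: "i = block_start m"
    using fw_La_block_start assms(3) by blast
  have "fw (i + L) = La"
    using agree[of i] assms by simp
  then obtain m' where m': "i + L = block_start m'"
    using fw_La_block_start by blast
  have "m < m'"
    using m m' assms(2) strict_mono_less[OF strict_mono_block_start, of m m'] by simp
  define M where "M = m' - m"
  have M: "m' = m + M" "1 \<le> M"
    using \<open>m < m'\<close> by (auto simp: M_def)
  have cnt: "count_a (i + L) = count_a i + M"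
    using m m' M by simp
  have L: "L = M + (count_a (m + M) - count_a m)"
    using m m' M count_a_mono[of m "m + M"] by (simp add: block_start_def)
  have "M < L"
  proof (cases "M = 1")
    case False
    then show ?thesis
      using count_a_add_2[of m] count_a_mono[of "m + 2" "m + M"] M L by linarith
  qed (use assms in simp)
  have step: "fw (m + t) = fw (m' + t)"
    if t: "Suc t < M" and al: "block_start (m' + t) = block_start (m + t) + L" for t
  proof -
    have le: "block_start (Suc (Suc (m + t))) \<le> i + L"
      using t M m' by (simp add: strict_mono_less_eq[OF strict_mono_block_start])
    \<comment> \<open>two consecutive blocks before the cut have at least three letters, as \<open>bb\<close> does not occur\<close>
    have "Suc (Suc (block_start (m + t))) < i + L"
      using le no_bb[of "m + t"] letter_cases[of "fw (m + t)"]
      by (auto simp: block_start_Suc split: if_splits)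
    moreover have "i \<le> block_start (m + t)"
      using m by (simp add: strict_mono_less_eq[OF strict_mono_block_start])
    ultimately have "fw (Suc (block_start (m + t))) = fw (Suc (block_start (m' + t)))"
      using agree[of "Suc (block_start (m + t))"] al by simp
    then show ?thesis
      using fw_Suc_block_start[of "m + t"] fw_Suc_block_start[of "m' + t"]
      by (cases "fw (m + t)"; cases "fw (m' + t)") simp_all
  qed
  have al: "block_start (m' + t) = block_start (m + t) + L" if "t < M" for t
    using that
  proof (induction t)
    case 0
    then show ?case using m m' by simp
  next
    case (Suc t)
    then show ?case using step[of t] by (simp add: block_start_Suc)
  qed
  have "near_square m M"
    unfolding near_square_def
  proof (intro conjI allI impI)
    fix j assume j: "m \<le> j \<and> Suc j < m + M"
    then have "fw (m + (j - m)) = fw (m' + (j - m))"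
      by (intro step al) auto
    then show "fw j = fw (j + M)"
      using j M by (simp add: algebra_simps)
  qed (use M in simp)
  with that \<open>M < L\<close> cnt L show thesis by blast
qed

text \<open>
  The descent ends at \<open>L = 1\<close> with the pair \<open>(1, 1)\<close> or \<open>(1, 0)\<close>. A near square starting with
  \<open>b\<close> is moved one position to the left, which is possible because both copies of its
  first letter are preceded by \<open>a\<close>.
\<close>
lemma near_square_fib:
  "near_square i L \<Longrightarrow> \<exists>k. L = fib (Suc k) \<and> count_a (i + L) = count_a i + fib k"
proof (induction L arbitrary: i rule: less_induct)
  case (less L)
  have starting_a: "\<exists>k. L = fib (Suc k) \<and> count_a (i + L) = count_a i + fib k"
    if i: "near_square i L" "2 \<le> L" "fw i = La" for i
  proof -
    obtain m M where M: "near_square m M" "M < L" "count_a (i + L) = count_a i + M"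
      "L = M + (count_a (m + M) - count_a m)"
      by (rule near_square_desubstitute[OF i])
    obtain k where "M = fib (Suc k)" "count_a (m + M) = count_a m + fib k"
      using less.IH[OF M(2,1)] by blast
    then show ?thesis using M(3,4) by (intro exI[of _ "Suc k"]) simp
  qed
  have "1 \<le> L" using less.prems by (simp add: near_square_def)
  then consider "L = 1" | "2 \<le> L" "fw i = La" | "2 \<le> L" "fw i = Lb"
    using letter_cases[of "fw i"] by linarith
  then show ?case
  proof cases
    case 1
    show ?thesis
    proof (cases "fw i")
      case La
      then show ?thesis using 1 by (intro exI[of _ 1]) simp
    next
      case Lb
      then show ?thesis using 1 by (intro exI[of _ 0]) simp
    qed
  next
    case 2
    then show ?thesis using starting_a less.prems by blast
  next
    case 3
    have "i \<noteq> 0" using 3 fw_block_start[of 0] by (metis block_start_0 letter.distinct(1))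
    then obtain h where h: "i = Suc h" by (cases i) auto
    have "fw (i + L) = Lb"
      using less.prems 3 by (auto simp: near_square_def)
    then have a: "fw h = La" "fw (h + L) = La"
      using 3 h no_bb letter_cases by (metis add_Suc letter.distinct(1))+
    have "near_square h L"
      unfolding near_square_def
    proof (intro conjI allI impI)
      fix j assume j: "h \<le> j \<and> Suc j < h + L"
      show "fw j = fw (j + L)"
        using less.prems j h a by (cases "j = h") (auto simp: near_square_def)
    qed (use 3 in simp)
    then show ?thesis using starting_a[OF _ 3(1) a(1)] a h by simp
  qed
qed

text \<open>
  A square with root length \<open>L\<close> that is a suffix of the prefix of length \<open>n\<close>, whether
  or not its root is primitive.
\<close>
definition square_period :: "nat \<Rightarrow> nat \<Rightarrow> bool" where
  "square_period n L \<longleftrightarrow> 1 \<le> L \<and> 2 * L \<le> n \<and> (\<forall>j. n - 2 * L \<le> j \<and> j < n - L \<longrightarrow> fw j = fw (j + L))"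

lemma square_period_fib:
  assumes "square_period n L"
  shows "\<exists>k. L = fib (Suc k) \<and> count_a (n - 2 * L + L) = count_a (n - 2 * L) + fib k"
proof (rule near_square_fib)
  show "near_square (n - 2 * L) L"
    unfolding near_square_def
  proof (intro conjI allI impI)
    fix j assume "n - 2 * L \<le> j \<and> Suc j < n - 2 * L + L"
    then have "n - 2 * L \<le> j \<and> j < n - L"
      using assms by (simp add: square_period_def)
    then show "fw j = fw (j + L)"
      using assms by (simp only: square_period_def)
  qed (use assms in \<open>simp add: square_period_def\<close>)
qed

lemma count_list_fw: "count_list (map fw [s..<s + L]) La = count_a (s + L) - count_a s"
proof (induction L)
  case (Suc L)
  then show ?case using count_a_mono[of s "s + L"] by (simp add: Suc_diff_le)
qed simp

lemma length_concat_replicate: "length (concat (replicate n zs)) = n * length zs"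
  by (induction n) auto

lemma count_list_concat_replicate: "count_list (concat (replicate n zs)) c = n * count_list zs c"
  by (induction n) auto

text \<open>
  Commuting words are powers of a common word, and the exponent of \<open>u @ v\<close> divides both its length
  and its letter counts.
\<close>
lemma coprime_commuting_imp_trivial:
  assumes "u @ v = v @ u" "coprime (count_list (u @ v) c) (length (u @ v))"
  shows "u = [] \<or> v = []"
proof -
  obtain k l z where z: "concat (replicate k z) = u" "concat (replicate l z) = v"
    using comm_append_are_replicate[OF assms(1)] by metis
  have uv: "u @ v = concat (replicate (k + l) z)"
    by (simp add: z replicate_add)
  have "k + l dvd count_list (u @ v) c" "k + l dvd length (u @ v)"
    unfolding uv length_concat_replicate count_list_concat_replicate by simp_all
  then have "k + l = 1"
    using assms(2) coprime_common_divisor_nat[of "count_list (u @ v) c" "length (u @ v)" "k + l"] by simp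
  then show ?thesis
    using z by (cases k) auto
qed

lemma occurs_at_iff: "occurs_at w i \<longleftrightarrow> 1 \<le> i \<and> (\<forall>t<length w. fw (i - 1 + t) = w ! t)"
  unfolding occurs_at_def
  by (auto simp: list_eq_iff_nth_eq sdrop_snth fw_def stake_nth)

text \<open>
  An occurrence of the root \<open>w\<close> strictly inside \<open>w w\<close> would factor \<open>w\<close> as \<open>u v = v u\<close>, which
  the coprimality of the length of \<open>w\<close> and its number of letters \<open>a\<close> excludes.
\<close>
lemma no_inner_occurrence:
  assumes sq: "square_period n L" and d: "0 < d" "d < L"
  shows "\<exists>t<L. fw (n - 2 * L + t) \<noteq> fw (n - 2 * L + d + t)"
proof (rule ccontr)
  define s where "s = n - 2 * L"
  assume "\<not> ?thesis"
  then have inner: "fw (s + d + t) = fw (s + t)" if "t < L" for t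
    using that by (auto simp: s_def)
  have outer: "fw (s + L + t) = fw (s + t)" if "t < L" for t
  proof -
    have "n - 2 * L \<le> s + t \<and> s + t < n - L"
      using sq that by (auto simp: s_def square_period_def)
    then have "fw (s + t) = fw (s + t + L)"
      using sq by (simp only: square_period_def)
    then show ?thesis by (simp add: ac_simps)
  qed
  define u v where "u = map fw [s..<s + d]" and "v = map fw [s + d..<s + L]"
  have uv: "u @ v = map fw [s..<s + L]"
    using d upt_add_eq_append[of s "s + d" "L - d"] by (simp add: u_def v_def)
  have "u @ v = v @ u"
    unfolding uv
  proof (rule nth_equalityI)
    show "length (map fw [s..<s + L]) = length (v @ u)"
      using d by (simp add: u_def v_def)
    fix t assume t: "t < length (map fw [s..<s + L])"
    show "map fw [s..<s + L] ! t = (v @ u) ! t"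
    proof (cases "t < L - d")
      case True
      then show ?thesis using t inner[of t] by (simp add: u_def v_def nth_append)
    next
      case False
      define r where "r = t - (L - d)"
      have r: "s + d + t = s + L + r" "r < L" "t < L" "r < d"
        using False t d by (auto simp: r_def)
      have "fw (s + t) = fw (s + L + r)"
        using inner[OF r(3)] by (simp only: r(1))
      then have "fw (s + t) = fw (s + r)"
        using outer[OF r(2)] by simp
      moreover have "(v @ u) ! t = fw (s + r)"
        using False d r(4) by (simp add: u_def v_def nth_append r_def)
      ultimately show ?thesis
        using r(3) by simp
    qed
  qed
  moreover obtain k where "L = fib (Suc k)" "count_a (s + L) = count_a s + fib k"
    using square_period_fib[OF sq] by (auto simp: s_def)
  then have "coprime (count_list (u @ v) La) (length (u @ v))"
    unfolding uv count_list_fw by (simp add: coprime_fib_Suc_nat)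
  ultimately have "u = [] \<or> v = []"
    by (rule coprime_commuting_imp_trivial)
  then show False using d by (simp add: u_def v_def)
qed

text \<open>
  The length of the root determines the root, as the end of the square is fixed, and the
  occurrence number \<open>p\<close> is then determined by the starting position. Conversely, since no
  occurrence lies strictly between the two halves, these have consecutive numbers.
\<close>
lemma sq_count_eq: "sq_count n = card {L. square_period n L}"
proof -
  define word where "word L = map fw [n - 2 * L..<n - L]" for L
  define idx where "idx L = card {j. j \<le> n - 2 * L + 1 \<and> occurs_at (word L) j}" for L
  have "bij_betw (\<lambda>L. (word L, idx L)) {L. square_period n L} {(w, p). square_ends_at w p n}"
  proof (rule bij_betw_byWitness[where f' = "\<lambda>(w, p). length w"])
    show "\<forall>L\<in>{L. square_period n L}. (case (word L, idx L) of (w, p) \<Rightarrow> length w) = L"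
      by (auto simp: word_def square_period_def)
    have fwd: "square_period n (length w) \<and> w = word (length w) \<and> p = idx (length w)"
      if "square_ends_at w p n" for w p
    proof -
      obtain i where i: "w \<noteq> []" "nth_occurrence w p i"
        "nth_occurrence w (p + 1) (i + length w)" "n + 1 = i + 2 * length w"
        using \<open>square_ends_at w p n\<close> by (auto simp: square_ends_at_def)
      let ?L = "length w"
      have i1: "i = n - 2 * ?L + 1" "2 * ?L \<le> n"
        using i by (auto simp: nth_occurrence_def occurs_at_def)
      have o1: "fw (n - 2 * ?L + t) = w ! t" if "t < ?L" for t
        using i that i1 by (auto simp: nth_occurrence_def occurs_at_iff)
      have o2: "fw (n - 2 * ?L + ?L + t) = w ! t" if "t < ?L" for t
        using i that i1 by (auto simp: nth_occurrence_def occurs_at_iff)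
      have "square_period n ?L"
        unfolding square_period_def
      proof (intro conjI allI impI)
        show "1 \<le> ?L" using i by (cases w) auto
        fix j assume "n - 2 * ?L \<le> j \<and> j < n - ?L"
        then obtain t where "j = n - 2 * ?L + t" "t < ?L"
          using i1 by (intro that[of "j - (n - 2 * ?L)"]) linarith+
        then show "fw j = fw (j + ?L)"
          using o1[of t] o2[of t] by (simp add: ac_simps)
      qed (use i1 in simp)
      moreover have w: "w = word ?L"
        using i1 o1 by (auto intro!: nth_equalityI simp: word_def)
      moreover have "p = idx ?L"
        using i i1 w by (simp add: idx_def nth_occurrence_def)
      ultimately show ?thesis by blast
    qed
    show "\<forall>z\<in>{(w, p). square_ends_at w p n}.
        (word (case z of (w, p) \<Rightarrow> length w), idx (case z of (w, p) \<Rightarrow> length w)) = z"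
      using fwd by auto
    show "(\<lambda>(w, p). length w) ` {(w, p). square_ends_at w p n} \<subseteq> {L. square_period n L}"
      using fwd by auto
    show "(\<lambda>L. (word L, idx L)) ` {L. square_period n L} \<subseteq> {(w, p). square_ends_at w p n}"
    proof clarsimp
      fix L assume sq: "square_period n L"
      let ?i = "n - 2 * L + 1" and ?w = "word L"
      have L: "1 \<le> L" "2 * L \<le> n" and len: "length ?w = L"
        using sq by (auto simp: square_period_def word_def)
      have nth: "?w ! t = fw (n - 2 * L + t)" if "t < L" for t
        using that L by (simp add: word_def)
      have o1: "occurs_at ?w ?i"
        by (auto simp: occurs_at_iff len nth)
      have o2: "occurs_at ?w (?i + L)"
      proof -
        have "fw (n - 2 * L + L + t) = fw (n - 2 * L + t)" if "t < L" for t
          using sq that L by (auto simp: square_period_def algebra_simps dest!: spec[of _ "n - 2 * L + t"])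
        then show ?thesis by (auto simp: occurs_at_iff len nth)
      qed
      have "j \<le> ?i" if "j \<le> ?i + L" "occurs_at ?w j" "j \<noteq> ?i + L" for j
      proof (rule ccontr)
        assume "\<not> j \<le> ?i"
        then have "0 < j - ?i" "j - ?i < L"
          using that L by linarith+
        then obtain t where "t < L" "fw (n - 2 * L + t) \<noteq> fw (n - 2 * L + (j - ?i) + t)"
          using no_inner_occurrence[OF sq] by blast
        then show False
          using that(2) \<open>\<not> j \<le> ?i\<close> by (auto simp: occurs_at_iff len nth)
      qed
      then have "{j. j \<le> ?i + L \<and> occurs_at ?w j} = insert (?i + L) {j. j \<le> ?i \<and> occurs_at ?w j}"
        using o2 by auto
      moreover have "?i + L \<notin> {j. j \<le> ?i \<and> occurs_at ?w j}"
        using L by auto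
      moreover have "finite {j. j \<le> ?i \<and> occurs_at ?w j}"
        by (rule finite_subset[of _ "{..?i}"]) auto
      ultimately have "card {j. j \<le> ?i + L \<and> occurs_at ?w j} = idx L + 1"
        by (simp add: idx_def)
      then show "square_ends_at ?w (idx L) n"
        unfolding square_ends_at_def nth_occurrence_def using o1 o2 L len
        by (auto intro!: exI[of _ ?i] simp: idx_def)
    qed
  qed
  then show ?thesis
    unfolding sq_count_def by (metis bij_betw_same_card)
qed

section \<open>The Fibonacci word against its shifts\<close>

lemma sigma_iter_rec: "sigma_iter (Suc (Suc n)) = sigma_iter (Suc n) @ sigma_iter n"
proof (induction n)
  case (Suc n)
  have "sigma_iter (Suc (Suc (Suc n))) = sigma_word (sigma_iter (Suc n) @ sigma_iter n)"
    using Suc by simp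
  then show ?case by (simp add: sigma_word_def)
qed (simp add: sigma_word_def)

lemma length_sigma_iter_fib: "length (sigma_iter n) = fib (n + 2)"
proof (induction n rule: fib.induct)
  case (3 n)
  then show ?case by (simp add: sigma_iter_rec del: sigma_iter.simps)
qed (simp_all add: sigma_word_def)

lemma stake_sigma_iter: "stake (length (sigma_iter n)) fib_word = sigma_iter n"
proof (induction n)
  case 0
  then show ?case using fib_word(1) by simp
next
  case (Suc n)
  have "stake (length (sigma_iter (Suc n))) (sigma_inf fib_word) = sigma_iter (Suc n)"
    by (subst stake_sigma_inf[of _ "length (sigma_iter n)"]) (use Suc in simp_all)
  then show ?case by (simp add: fib_word(2))
qed

lemma fw_sigma_iter: "j < fib (n + 2) \<Longrightarrow> fw j = sigma_iter n ! j"
  by (metis fw_def length_sigma_iter_fib stake_nth stake_sigma_iter)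

lemma fw_add_fib_small: "j < fib (n + 2) \<Longrightarrow> fw (j + fib (n + 3)) = fw j"
  using fw_sigma_iter[of "j + fib (n + 3)" "n + 2"] fw_sigma_iter[of j n] length_sigma_iter_fib[of "Suc n"]
  by (simp add: sigma_iter_rec nth_append eval_nat_numeral del: sigma_iter.simps)

lemma fw_small: "fw 0 = La" "fw 1 = Lb" "fw 2 = La"
  using fw_sigma_iter[of _ 2] by (auto simp: sigma_word_def eval_nat_numeral)

text \<open>
  The standard near-commutativity of consecutive finite Fibonacci words, expressed on positions:
  \<open>x\<close> agrees with its shift by \<open>fib (n + 2)\<close> on the first \<open>fib (n + 3) - 2\<close> positions and differs
  on the next two. This lemma and the next use the same induction: cutting off a prefix of length
  \<open>fib (n + 2)\<close> turns the comparison with shift \<open>fib (n + 3)\<close> into the one with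
  shift \<open>fib (n + 2)\<close>.
\<close>
lemma fw_add_fib_eq: "j + 2 < fib (n + 3) \<Longrightarrow> fw (j + fib (n + 2)) = fw j"
proof (induction n arbitrary: j)
  case 0
  then show ?case by (simp add: eval_nat_numeral)
next
  case (Suc n)
  show ?case
  proof (cases "j < fib (n + 2)")
    case True
    then show ?thesis using fw_add_fib_small[of j n] by (simp add: eval_nat_numeral)
  next
    case False
    then obtain i where i: "j = fib (n + 2) + i" by (metis le_Suc_ex not_less)
    have f: "fib (Suc n + 3) = fib (n + 3) + fib (n + 2)" by (simp add: eval_nat_numeral)
    have "i + 2 < fib (n + 3)" using Suc.prems i f by simp
    then have "fw j = fw i" using Suc.IH[of i] i by (simp add: add.commute)
    moreover have "fw (j + fib (Suc n + 2)) = fw (i + fib (Suc n + 3))"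
      by (simp add: i eval_nat_numeral algebra_simps)
    moreover have "\<dots> = fw i"
      using \<open>i + 2 < fib (n + 3)\<close> fw_add_fib_small[of i "Suc n"] by (simp add: eval_nat_numeral)
    ultimately show ?thesis by simp
  qed
qed

lemma fw_add_fib_neq:
  "fib (n + 3) \<le> j + 2 \<Longrightarrow> j < fib (n + 3) \<Longrightarrow> fw (j + fib (n + 2)) \<noteq> fw j"
proof (induction n arbitrary: j)
  case 0
  then have "j = 0 \<or> j = 1" by (auto simp: eval_nat_numeral)
  then show ?case using fw_small by (auto simp: eval_nat_numeral)
next
  case (Suc n)
  have f: "fib (Suc n + 3) = fib (n + 3) + fib (n + 2)" by (simp add: eval_nat_numeral)
  have "2 \<le> fib (n + 3)" using fib_mono[of 3 "n + 3"] by (simp add: eval_nat_numeral)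
  then have "fib (n + 2) \<le> j" using Suc.prems(1) f by linarith
  then obtain i where i: "j = fib (n + 2) + i" by (metis le_Suc_ex)
  have "fib (n + 3) \<le> i + 2" "i < fib (n + 3)" using Suc.prems i f by auto
  then have "fw j \<noteq> fw i" using Suc.IH[of i] i by (simp add: add.commute)
  moreover have "fw (j + fib (Suc n + 2)) = fw (i + fib (Suc n + 3))"
    by (simp add: i eval_nat_numeral algebra_simps)
  moreover have "\<dots> = fw i"
    using \<open>i < fib (n + 3)\<close> fw_add_fib_small[of i "Suc n"] by (simp add: eval_nat_numeral)
  ultimately show ?case by simp
qed

text \<open>
  Both positions are traced back to position \<open>j - fib (n + 3)\<close>, the first by the period
  \<open>fib (n + 3)\<close>, the second by the period \<open>fib (n + 4)\<close> of a longer prefix.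
\<close>
lemma fw_add_fib_eq_second_run:
  assumes "fib (n + 3) \<le> j" "j + 2 < fib (n + 5)"
  shows "fw (j + fib (n + 2)) = fw j"
proof -
  obtain i where i: "j = fib (n + 3) + i" using assms(1) by (metis le_Suc_ex)
  have f: "fib (n + 5) = fib (n + 4) + fib (n + 3)" "fib (n + 4) = fib (n + 3) + fib (n + 2)"
    by (simp_all add: eval_nat_numeral)
  have il: "i + 2 < fib (n + 4)" using assms i f by simp
  have "fw j = fw i"
    using fw_add_fib_eq[of i "n + 1"] il i by (simp add: eval_nat_numeral add.commute)
  moreover have "fw (i + fib (n + 4)) = fw i"
    using fw_add_fib_eq[of i "n + 2"] il f by (simp add: eval_nat_numeral)
  moreover have "j + fib (n + 2) = i + fib (n + 4)"
    using i f by simp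
  ultimately show ?thesis by simp
qed


section \<open>Counting squares\<close>

lemma finite_square_period: "finite {L. square_period n L}"
  by (rule finite_subset[of _ "{..n}"]) (auto simp: square_period_def)

lemma square_period_shift:
  assumes "n + 2 \<le> fib (k + 2) + fib (k + 3)"
  shows "square_period n L \<and> fib (k + 2) + 2 * L \<le> n \<longleftrightarrow> square_period (n - fib (k + 2)) L \<and> fib (k + 2) \<le> n"
proof -
  let ?F = "fib (k + 2)"
  have "square_period n L \<longleftrightarrow> square_period (n - ?F) L" if L: "?F + 2 * L \<le> n" "1 \<le> L"
  proof -
    have per: "fw (i + ?F) = fw i" if "i < n - ?F" for i
      using assms that by (intro fw_add_fib_eq) linarith
    have "(\<forall>j. n - 2 * L \<le> j \<and> j < n - L \<longrightarrow> fw j = fw (j + L)) \<longleftrightarrow>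
      (\<forall>j. n - ?F - 2 * L \<le> j \<and> j < n - ?F - L \<longrightarrow> fw (j + ?F) = fw (j + L + ?F))"
    proof (intro iffI allI impI)
      fix j assume *: "\<forall>j. n - 2 * L \<le> j \<and> j < n - L \<longrightarrow> fw j = fw (j + L)"
        and "n - ?F - 2 * L \<le> j \<and> j < n - ?F - L"
      then have "n - 2 * L \<le> j + ?F \<and> j + ?F < n - L" using L by linarith
      with * have "fw (j + ?F) = fw (j + ?F + L)" by blast
      then show "fw (j + ?F) = fw (j + L + ?F)" by (simp only: ac_simps)
    next
      fix j assume *: "\<forall>j. n - ?F - 2 * L \<le> j \<and> j < n - ?F - L \<longrightarrow> fw (j + ?F) = fw (j + L + ?F)"
        and j: "n - 2 * L \<le> j \<and> j < n - L"
      then have "n - ?F - 2 * L \<le> j - ?F \<and> j - ?F < n - ?F - L" "?F \<le> j"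
        using L by linarith+
      then have "fw (j - ?F + ?F) = fw (j - ?F + L + ?F)" using * by blast
      with \<open>?F \<le> j\<close> show "fw j = fw (j + L)" by simp
    qed
    also have "\<dots> \<longleftrightarrow> (\<forall>j. n - ?F - 2 * L \<le> j \<and> j < n - ?F - L \<longrightarrow> fw j = fw (j + L))"
    proof -
      have "fw (j + ?F) = fw j" "fw (j + L + ?F) = fw (j + L)" if "j < n - ?F - L" for j
        using that by (intro per; linarith)+
      then show ?thesis by metis
    qed
    finally show ?thesis using L unfolding square_period_def by auto
  qed
  then show ?thesis by (auto simp: square_period_def simp del: fib.simps)
qed

lemma fib_rec: "fib (k + 2) = fib (k + 1) + fib k" "fib (k + 3) = fib (k + 2) + fib (k + 1)"
  "fib (k + 4) = fib (k + 3) + fib (k + 2)" "fib (k + 5) = fib (k + 4) + fib (k + 3)"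
  "fib (k + 6) = fib (k + 5) + fib (k + 4)"
  by (simp_all add: eval_nat_numeral)

text \<open>
  A square of the middle length \<open>fib (q + 3)\<close> in this range would contain in its first
  half one of the first two positions where \<open>x\<close> differs from its shift by \<open>fib (q + 3)\<close>. For the length \<open>fib (q + 2)\<close> the
  first half lies within the second run of agreement, and the condition on the start is what
  bounds \<open>n\<close>. For \<open>fib (q + 4)\<close> the first half lies within the first run.
\<close>
lemma new_squares:
  assumes q: "2 \<le> q" and n: "fib (q + 5) \<le> n + 1" "n + 2 \<le> fib (q + 6)"
  shows "{L. square_period n L \<and> n < fib (q + 4) + 2 * L} =
    (if 2 * fib (q + 4) \<le> n then {fib (q + 4)}
     else if n < fib (q + 5) + fib q then {fib (q + 2)} else {})"
proof -
  have pos: "1 \<le> fib q" "1 \<le> fib (q + 1)"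
    using fib_neq_0_nat[of q] fib_neq_0_nat[of "q + 1"] q by auto
  note r = fib_rec[of q]
  have cases_L: "L \<in> {fib (q + 2), fib (q + 3), fib (q + 4)}"
    if L: "square_period n L" "n < fib (q + 4) + 2 * L" for L
  proof -
    obtain k where k: "L = fib (Suc k)" using square_period_fib L(1) by blast
    have "2 * L \<le> n" using L(1) by (simp add: square_period_def)
    have "q + 2 \<le> Suc k"
    proof (rule ccontr)
      assume "\<not> ?thesis"
      then have "L \<le> fib (q + 1)" unfolding k by (intro fib_mono) simp
      then show False using L(2) n r pos by linarith
    qed
    moreover have "Suc k \<le> q + 4"
    proof (rule ccontr)
      assume "\<not> ?thesis"
      then have "fib (q + 5) \<le> L" unfolding k by (intro fib_mono) simp
      then show False using \<open>2 * L \<le> n\<close> n r pos by linarith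
    qed
    ultimately have "Suc k = q + 2 \<or> Suc k = q + 3 \<or> Suc k = q + 4" by linarith
    then have "fib (Suc k) = fib (q + 2) \<or> fib (Suc k) = fib (q + 3) \<or> fib (Suc k) = fib (q + 4)"
      by (elim disjE; simp only: simp_thms)
    then show ?thesis using k by blast
  qed
  have large: "square_period n (fib (q + 4)) \<longleftrightarrow> 2 * fib (q + 4) \<le> n"
  proof
    assume le: "2 * fib (q + 4) \<le> n"
    show "square_period n (fib (q + 4))"
      unfolding square_period_def
    proof (intro conjI allI impI)
      fix j assume "n - 2 * fib (q + 4) \<le> j \<and> j < n - fib (q + 4)"
      then have "j + 2 < fib (q + 5)" using n r by linarith
      then show "fw j = fw (j + fib (q + 4))"
        using fw_add_fib_eq[of j "q + 2"] by (simp add: eval_nat_numeral)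
    qed (use le pos r in linarith)+
  qed (simp add: square_period_def)
  have middle: "\<not> (square_period n (fib (q + 3)) \<and> n < fib (q + 4) + 2 * fib (q + 3))"
  proof
    assume *: "square_period n (fib (q + 3)) \<and> n < fib (q + 4) + 2 * fib (q + 3)"
    \<comment> \<open>of the two mismatches \<open>fib (q + 4) - 2\<close> and \<open>fib (q + 4) - 1\<close>, the first one lies in the
      first half unless the square starts right after it\<close>
    define j where "j = max (n - 2 * fib (q + 3)) (fib (q + 4) - 2)"
    have "n - 2 * fib (q + 3) \<le> j \<and> j < n - fib (q + 3)" "fib (q + 4) \<le> j + 2" "j < fib (q + 4)"
      using * n r pos by (auto simp: j_def max_def simp del: fib.simps)
    moreover from this have "fw j = fw (j + fib (q + 3))"
      using * by (simp only: square_period_def)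
    ultimately show False
      using fw_add_fib_neq[of "q + 1" j] by (simp add: eval_nat_numeral)
  qed
  have small: "square_period n (fib (q + 2)) \<and> n < fib (q + 4) + 2 * fib (q + 2) \<longleftrightarrow> n < fib (q + 5) + fib q"
  proof -
    have eq: "fib (q + 4) + 2 * fib (q + 2) = fib (q + 5) + fib q" using r by linarith
    have "square_period n (fib (q + 2))" if lt: "n < fib (q + 5) + fib q"
      unfolding square_period_def
    proof (intro conjI allI impI)
      fix j assume "n - 2 * fib (q + 2) \<le> j \<and> j < n - fib (q + 2)"
      then have "fib (q + 3) \<le> j" "j + 2 < fib (q + 5)" using n r pos lt by linarith+
      then show "fw j = fw (j + fib (q + 2))"
        using fw_add_fib_eq_second_run[of q j] by simp
    qed (use n pos r in linarith)+
    then show ?thesis using eq by auto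
  qed
  have excl: "\<not> (2 * fib (q + 4) \<le> n \<and> n < fib (q + 5) + fib q)"
    using r pos by linarith
  have "n < fib (q + 4) + 2 * fib (q + 4)" using n r pos by linarith
  then have "square_period n L \<and> n < fib (q + 4) + 2 * L \<longleftrightarrow>
      L = fib (q + 4) \<and> 2 * fib (q + 4) \<le> n \<or> L = fib (q + 2) \<and> n < fib (q + 5) + fib q" for L
    using cases_L[of L] large middle small by blast
  then show ?thesis using excl by auto
qed

lemma sq_count_rec:
  assumes q: "2 \<le> q" and n: "fib (q + 5) \<le> n + 1" "n + 2 \<le> fib (q + 6)"
  shows "sq_count n = sq_count (n - fib (q + 4)) +
    (if 2 * fib (q + 4) \<le> n \<or> n < fib (q + 5) + fib q then 1 else 0)"
proof -
  let ?F = "fib (q + 4)"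
  have le: "?F \<le> n"
    using n fib_rec(4)[of q] fib_neq_0_nat[of "q + 3"] by linarith
  have "{L. square_period n L} = {L. square_period n L \<and> ?F + 2 * L \<le> n}
      \<union> {L. square_period n L \<and> n < ?F + 2 * L}"
    by auto
  also have "{L. square_period n L \<and> ?F + 2 * L \<le> n} = {L. square_period (n - ?F) L}"
  proof -
    have *: "q + 2 + 2 = q + 4" "q + 2 + 3 = q + 5" by simp_all
    have "n + 2 \<le> ?F + fib (q + 5)" using n(2) fib_rec[of q] by linarith
    then show ?thesis
      using square_period_shift[of n "q + 2", unfolded *] le by blast
  qed
  finally have "sq_count n = card ({L. square_period (n - ?F) L} \<union> {L. square_period n L \<and> n < ?F + 2 * L})"
    by (simp add: sq_count_eq)
  also have "\<dots> = sq_count (n - ?F) + card {L. square_period n L \<and> n < ?F + 2 * L}"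
    unfolding sq_count_eq
  proof (rule card_Un_disjoint)
    show "{L. square_period (n - ?F) L} \<inter> {L. square_period n L \<and> n < ?F + 2 * L} = {}"
    proof -
      have "\<not> n < ?F + 2 * L" if "square_period (n - ?F) L" for L
        using that le unfolding square_period_def by linarith
      then show ?thesis by blast
    qed
    show "finite {L. square_period n L \<and> n < ?F + 2 * L}"
      by (rule finite_subset[OF _ finite_square_period[of n]]) auto
  qed (rule finite_square_period)
  finally show ?thesis
    unfolding new_squares[OF assms] by simp
qed

text \<open>For the initial values: \<open>sigma_iter 5\<close> is the prefix of length \<open>13\<close>.\<close>
lemma sq_count_code:
  assumes "n \<le> 13"
  shows "sq_count n = length (filter (\<lambda>L. take L (drop (n - 2 * L) (sigma_iter 5))
    = take L (drop (n - L) (sigma_iter 5))) [1..<Suc (n div 2)])"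
proof -
  let ?u = "sigma_iter 5"
  have len: "length ?u = 13"
    unfolding length_sigma_iter_fib by (simp add: eval_nat_numeral)
  have fw: "fw j = ?u ! j" if "j < 13" for j
    using fw_sigma_iter[of j 5] that by (simp add: eval_nat_numeral)
  have "square_period n L \<longleftrightarrow> L \<in> set [1..<Suc (n div 2)] \<and> take L (drop (n - 2 * L) ?u) = take L (drop (n - L) ?u)"
    for L
  proof (cases "1 \<le> L \<and> 2 * L \<le> n")
    case True
    have "(\<forall>j. n - 2 * L \<le> j \<and> j < n - L \<longrightarrow> fw j = fw (j + L)) \<longleftrightarrow>
        (\<forall>t<L. fw (n - 2 * L + t) = fw (n - L + t))"
    proof (intro iffI allI impI)
      fix t assume *: "\<forall>j. n - 2 * L \<le> j \<and> j < n - L \<longrightarrow> fw j = fw (j + L)" and "t < L"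
      then show "fw (n - 2 * L + t) = fw (n - L + t)"
        using True by (auto dest!: spec[of _ "n - 2 * L + t"] simp: algebra_simps)
    next
      fix j assume *: "\<forall>t<L. fw (n - 2 * L + t) = fw (n - L + t)" and "n - 2 * L \<le> j \<and> j < n - L"
      then show "fw j = fw (j + L)"
        using True by (auto dest!: spec[of _ "j - (n - 2 * L)"] simp: algebra_simps)
    qed
    also have "\<dots> \<longleftrightarrow> take L (drop (n - 2 * L) ?u) = take L (drop (n - L) ?u)"
      using True assms len by (auto simp: list_eq_iff_nth_eq fw)
    finally show ?thesis using True by (auto simp: square_period_def)
  qed (auto simp: square_period_def)
  then have "{L. square_period n L} = set (filter (\<lambda>L. take L (drop (n - 2 * L) ?u)
      = take L (drop (n - L) ?u)) [1..<Suc (n div 2)])"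
    by auto
  then show ?thesis
    unfolding sq_count_eq by (simp only: distinct_card distinct_filter distinct_upt)
qed

lemma sq_count_small:
  "sq_count 1 = 0" "sq_count 2 = 0" "sq_count 3 = 0" "sq_count 4 = 1" "sq_count 5 = 0"
  "sq_count 6 = 1" "sq_count 7 = 1" "sq_count 8 = 1" "sq_count 9 = 1" "sq_count 10 = 1"
  "sq_count 11 = 2"
  by (subst sq_count_code, simp, code_simp)+

lemma Gamma_fib:
  "Gamma1 (int k + 1) = [2 * fib (k + 4) - 1..<fib (k + 6) - 1]"
  "Gamma2 (int k + 1) = [fib (k + 5) - 1..<2 * fib (k + 4) - 1]"
proof -
  have nat: "nat (int k + 1 + 1 + 2) = k + 4" "nat (int k + 1 + 3 + 2) = k + 6" "nat (int k + 1 + 2 + 2) = k + 5"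
    by simp_all
  have "1 \<le> fib (k + 3)" "1 \<le> fib (k + 2)" "1 \<le> fib (k + 4)"
    using fib_neq_0_nat[of "k + 3"] fib_neq_0_nat[of "k + 2"] fib_neq_0_nat[of "k + 4"] by auto
  then have "Suc (fib (k + 6) - 2) = fib (k + 6) - 1" "Suc (2 * fib (k + 4) - 2) = 2 * fib (k + 4) - 1"
    using fib_rec[of k] by linarith+
  then show "Gamma1 (int k + 1) = [2 * fib (k + 4) - 1..<fib (k + 6) - 1]"
    "Gamma2 (int k + 1) = [fib (k + 5) - 1..<2 * fib (k + 4) - 1]"
    unfolding Gamma1_def Gamma2_def fib_sh_def nat by metis+
qed

text \<open>
  The two lists are adjacent intervals, so each recurrence is about a single shift of positions.
\<close>
lemma Gamma2_append_Gamma1: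
  "Gamma2 (int k + 1) @ Gamma1 (int k + 1) = [fib (k + 5) - 1..<fib (k + 6) - 1]"
proof -
  have "fib (k + 5) - 1 \<le> 2 * fib (k + 4) - 1" "2 * fib (k + 4) - 1 \<le> fib (k + 6) - 1"
    using fib_rec[of k] by linarith+
  then show ?thesis
    unfolding Gamma_fib by (metis le_Suc_ex upt_add_eq_append)
qed

lemma Gamma_rec:
  assumes q: "2 \<le> q"
  shows "map sq_count (Gamma1 (int q + 1)) =
      vec_add (map sq_count (Gamma2 (int q) @ Gamma1 (int q))) ([0] @ replicate (fib (q + 3) - 1) 1)"
    and "map sq_count (Gamma2 (int q + 1)) =
      vec_add (map sq_count (Gamma2 (int q - 1) @ Gamma1 (int q - 1)))
        (replicate (fib q + 1) 1 @ replicate (fib (q + 1) - 1) 0)"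
proof -
  obtain p where p: "q = p + 2" using q by (metis le_Suc_ex add.commute)
  have pos: "1 \<le> fib q" "1 \<le> fib (q + 1)" "1 \<le> fib (q + 2)"
    using fib_neq_0_nat[of q] fib_neq_0_nat[of "q + 1"] fib_neq_0_nat[of "q + 2"] q by auto
  note r = fib_rec[of q]
  have i: "int q = int (p + 1) + 1" "int q - 1 = int p + 1" using p by auto
  have G: "Gamma2 (int q) @ Gamma1 (int q) = [fib (q + 4) - 1..<fib (q + 5) - 1]"
    "Gamma2 (int q - 1) @ Gamma1 (int q - 1) = [fib (q + 3) - 1..<fib (q + 4) - 1]"
  proof -
    have "p + 1 + 5 = q + 4" "p + 1 + 6 = q + 5" "p + 5 = q + 3" "p + 6 = q + 4"
      using p by simp_all
    then show "Gamma2 (int q) @ Gamma1 (int q) = [fib (q + 4) - 1..<fib (q + 5) - 1]"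
      "Gamma2 (int q - 1) @ Gamma1 (int q - 1) = [fib (q + 3) - 1..<fib (q + 4) - 1]"
      using Gamma2_append_Gamma1[of "p + 1"] Gamma2_append_Gamma1[of p] i by metis+
  qed
  show "map sq_count (Gamma1 (int q + 1)) =
      vec_add (map sq_count (Gamma2 (int q) @ Gamma1 (int q))) ([0] @ replicate (fib (q + 3) - 1) 1)"
    unfolding G Gamma_fib vec_add_def
  proof (rule nth_equalityI)
    show "length (map sq_count [2 * fib (q + 4) - 1..<fib (q + 6) - 1]) =
      length (map2 (+) (map sq_count [fib (q + 4) - 1..<fib (q + 5) - 1]) ([0] @ replicate (fib (q + 3) - 1) 1))"
      using r pos by (simp del: fib.simps)
    fix t assume "t < length (map sq_count [2 * fib (q + 4) - 1..<fib (q + 6) - 1])"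
    then have t: "t < fib (q + 3)" using r by (simp del: fib.simps)
    define n where "n = 2 * fib (q + 4) - 1 + t"
    have "sq_count n = sq_count (n - fib (q + 4)) + (if t = 0 then 0 else 1)"
    proof -
      have "(2 * fib (q + 4) \<le> n \<or> n < fib (q + 5) + fib q) \<longleftrightarrow> t \<noteq> 0"
        using r pos t unfolding n_def by linarith
      moreover have "fib (q + 5) \<le> n + 1" "n + 2 \<le> fib (q + 6)"
        using r pos t unfolding n_def by linarith+
      ultimately show ?thesis using sq_count_rec[OF q, of n] by simp
    qed
    moreover have "n - fib (q + 4) = fib (q + 4) - 1 + t"
      using r pos unfolding n_def by linarith
    ultimately show "map sq_count [2 * fib (q + 4) - 1..<fib (q + 6) - 1] ! t =
      map2 (+) (map sq_count [fib (q + 4) - 1..<fib (q + 5) - 1]) ([0] @ replicate (fib (q + 3) - 1) 1) ! t"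
      using t r pos by (simp add: n_def nth_Cons' del: fib.simps)
  qed
  show "map sq_count (Gamma2 (int q + 1)) =
      vec_add (map sq_count (Gamma2 (int q - 1) @ Gamma1 (int q - 1)))
        (replicate (fib q + 1) 1 @ replicate (fib (q + 1) - 1) 0)"
    unfolding G Gamma_fib vec_add_def
  proof (rule nth_equalityI)
    show "length (map sq_count [fib (q + 5) - 1..<2 * fib (q + 4) - 1]) =
      length (map2 (+) (map sq_count [fib (q + 3) - 1..<fib (q + 4) - 1])
        (replicate (fib q + 1) 1 @ replicate (fib (q + 1) - 1) 0))"
      using r pos by (simp del: fib.simps)
    fix t assume "t < length (map sq_count [fib (q + 5) - 1..<2 * fib (q + 4) - 1])"
    then have t: "t < fib (q + 2)" using r by (simp del: fib.simps)
    define n where "n = fib (q + 5) - 1 + t"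
    have "sq_count n = sq_count (n - fib (q + 4)) + (if t < fib q + 1 then 1 else 0)"
    proof -
      have "(2 * fib (q + 4) \<le> n \<or> n < fib (q + 5) + fib q) \<longleftrightarrow> t < fib q + 1"
        using r pos t unfolding n_def by linarith
      moreover have "fib (q + 5) \<le> n + 1" "n + 2 \<le> fib (q + 6)"
        using r pos t unfolding n_def by linarith+
      ultimately show ?thesis using sq_count_rec[OF q, of n] by simp
    qed
    moreover have "n - fib (q + 4) = fib (q + 3) - 1 + t"
      using r pos unfolding n_def by linarith
    ultimately show "map sq_count [fib (q + 5) - 1..<2 * fib (q + 4) - 1] ! t =
      map2 (+) (map sq_count [fib (q + 3) - 1..<fib (q + 4) - 1])
        (replicate (fib q + 1) 1 @ replicate (fib (q + 1) - 1) 0) ! t"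
      using t r pos by (simp add: n_def nth_append del: fib.simps replicate.simps)
  qed
qed

theorem mainTheorem4:
  shows "sq_count 1 = 0 \<and> sq_count 2 = 0 \<and> sq_count 3 = 0
    \<and> map sq_count (Gamma2 1) = map sq_count [4] \<and> map sq_count [4] = [1]
    \<and> map sq_count (Gamma1 1) = map sq_count [5, 6] \<and> map sq_count [5, 6] = [0, 1]
    \<and> map sq_count (Gamma2 2) = map sq_count [7, 8] \<and> map sq_count [7, 8] = [1, 1]
    \<and> map sq_count (Gamma1 2) = map sq_count [9, 10, 11] \<and> map sq_count [9, 10, 11] = [1, 1, 2]
    \<and> (\<forall>m::int. m \<ge> 3 \<longrightarrow>
         map sq_count (Gamma1 m) =
           vec_add (map sq_count (Gamma2 (m - 1)) @ map sq_count (Gamma1 (m - 1)))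
                   ([0] @ replicate (fib_sh m - 1) 1)
       \<and> map sq_count (Gamma2 m) =
           vec_add (map sq_count (Gamma2 (m - 2)) @ map sq_count (Gamma1 (m - 2)))
                   (replicate (fib_sh (m - 3) + 1) 1 @ replicate (fib_sh (m - 2) - 1) 0))"
proof (intro conjI allI impI)
  have G: "Gamma2 1 = [4]" "Gamma1 1 = [5, 6]" "Gamma2 2 = [7, 8]" "Gamma1 2 = [9, 10, 11]"
    using Gamma_fib[of 0] Gamma_fib[of 1] by (simp_all add: eval_nat_numeral)
  show "map sq_count (Gamma2 1) = map sq_count [4]" "map sq_count (Gamma1 1) = map sq_count [5, 6]"
    "map sq_count (Gamma2 2) = map sq_count [7, 8]" "map sq_count (Gamma1 2) = map sq_count [9, 10, 11]"
    by (simp_all only: G)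
  show "map sq_count [4] = [1]" "map sq_count [5, 6] = [0, 1]" "map sq_count [7, 8] = [1, 1]"
    "map sq_count [9, 10, 11] = [1, 1, 2]"
    by (simp_all add: sq_count_small)
  fix m :: int assume "3 \<le> m"
  then obtain q where q: "m = int q + 1" "2 \<le> q"
    by (intro that[of "nat (m - 1)"]) auto
  have "nat (int q + 1 + 2) = q + 3" "nat (int q + 1 - 3 + 2) = q" "nat (int q + 1 - 2 + 2) = q + 1"
    by simp_all
  then have f: "fib_sh m = fib (q + 3)" "fib_sh (m - 3) = fib q" "fib_sh (m - 2) = fib (q + 1)"
    by (simp_all only: fib_sh_def q)
  have i: "m - 1 = int q" "m - 2 = int q - 1" using q by auto
  show "map sq_count (Gamma1 m) =
      vec_add (map sq_count (Gamma2 (m - 1)) @ map sq_count (Gamma1 (m - 1)))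
        ([0] @ replicate (fib_sh m - 1) 1)"
    using Gamma_rec(1)[OF q(2)] unfolding f unfolding i by (simp only: q map_append)
  show "map sq_count (Gamma2 m) =
      vec_add (map sq_count (Gamma2 (m - 2)) @ map sq_count (Gamma1 (m - 2)))
        (replicate (fib_sh (m - 3) + 1) 1 @ replicate (fib_sh (m - 2) - 1) 0)"
    using Gamma_rec(2)[OF q(2)] unfolding f unfolding i by (simp only: q map_append)
qed (fact sq_count_small)+

end
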